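(* Let $K\ge1$ be an integer. Under Swerling I radar-cross-section fluctuation and non-coherent integration over $K$ independent coherent processing intervals (CPIs), the sensing outage probability at operational range $R_{\mathrm{target}}(\theta)>0$ and orbital phase $\theta$ is $$P_{\mathrm{out}}(\theta,K)=F_\Gamma\!\left(K\left(\frac{R_{\mathrm{target}}(\theta)}{R_{\max,\mathrm{det}}(\theta)}\right)^{4};\,K,\,1\right),$$ where $R_{\max,\mathrm{det}}(\theta)>0$ is the deterministic detection range computed with the mean radar cross section $\bar\sigma$, and $F_\Gamma(\cdot;k,1)$ is the CDF of the Gamma distribution with shape parameter $k$ and unit scale.
   Context: Swerling I fluctuation over independent CPIs: the per-CPI radar cross sections $\sigma_1,\ldots,\sigma_K$ are i.i.d. exponential with mean $\bar\sigma>0$. At range $R>0$ (and phase $\theta$) the nominal per-CPI SNR at the mean cross section is $\bar\gamma(R)=a(\theta)R^{-4}$ for some $a(\theta)>0$ not depending on $R$. The realized SNR in CPI $k$ is $\gamma_k(R)=\bar\gamma(R)\,\sigma_k/\bar\sigma$, and the integrated test statistic is $\Gamma_K(R)=\sum_{k=1}^K\gamma_k(R)$. The deterministic detection range $R_{\max,\mathrm{det}}(\theta)$ is the maximum detection range with the cross section fixed at its mean, i.e. $$R_{\max,\mathrm{det}}(\theta)=\left[\frac{\mathrm{EIRP}\cdot G_r\lambda^2\bar\sigma\,NM\,\mathcal{G}(v_{\mathrm{rel}}(\theta))K^\kappa}{(4\pi)^3k_BT_{\mathrm{sys}}B\,\gamma_{\mathrm{th}}}\right]^{1/4}.$$ Here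 the radiated power $\mathrm{EIRP}$, gain $G_r$, wavelength $\lambda$, subcarrier number $N$, symbols per CPI $M$, processing efficiency $\mathcal{G}$ at relative velocity $v_{\mathrm{rel}}(\theta)$, Boltzmann constant $k_B$, system temperature $T_{\mathrm{sys}}$, bandwidth $B$, single-CPI detection threshold $\gamma_{\mathrm{th}}$ and integration exponent $\kappa\approx0.85$ are all positive. The $K$-interval integration threshold $\gamma_{\mathrm{th}}^{(K)}$ on $\Gamma_K$ satisfies $K\bar\gamma(R_{\max,\mathrm{det}}(\theta))=\gamma_{\mathrm{th}}^{(K)}$. The sensing outage probability is the probability that the instantaneous detection range falls below the requirement $R_{\mathrm{target}}(\theta)$, i.e. $P_{\mathrm{out}}(\theta,K)=\Pr\bigl(\Gamma_K(R_{\mathrm{target}}(\theta))<\gamma_{\mathrm{th}}^{(K)}\bigr)$. *)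

theory Defs
  imports "HOL-Probability.Probability"
begin

definition gamma_density :: "real \<Rightarrow> real \<Rightarrow> real \<Rightarrow> real" where
  "gamma_density k s x =
     (if x \<le> 0 then 0 else x powr (k - 1) * exp (- x / s) / (Gamma k * s powr k))"

definition gamma_cdf :: "real \<Rightarrow> real \<Rightarrow> real \<Rightarrow> real" where
  "gamma_cdf k s x = cdf (density lborel (\<lambda>t. ennreal (gamma_density k s t))) x"

record radar_params =
  EIRP :: real
  rx_gain :: real
  wavelength :: real
  subcarriers :: nat
  symbols_per_CPI :: nat
  proc_efficiency :: "real \<Rightarrow> real" \<comment> \<open>as a function of the relative velocity\<close>
  rel_velocity :: "real \<Rightarrow> real" \<comment> \<open>as a function of the orbital phase\<close>
  boltzmann_const :: real
  sys_temperature :: real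
  bandwidth :: real
  snr_threshold :: real \<comment> \<open>single-CPI detection threshold\<close>
  integ_exponent :: real

definition det_range :: "radar_params \<Rightarrow> real \<Rightarrow> nat \<Rightarrow> real \<Rightarrow> real" where
  "det_range S rcs K \<theta> =
     ((EIRP S * (rx_gain S * (wavelength S)\<^sup>2 * rcs * real (subcarriers S) * real (symbols_per_CPI S)
         * proc_efficiency S (rel_velocity S \<theta>) * real K powr integ_exponent S))
      / ((4 * pi) ^ 3 * boltzmann_const S * sys_temperature S * bandwidth S * snr_threshold S))
     powr (1 / 4)"

text \<open>The argument \<open>a\<close> is the phase-dependent range-free factor of the mean SNR.\<close>

definition mean_snr :: "(real \<Rightarrow> real) \<Rightarrow> real \<Rightarrow> real \<Rightarrow> real" where
  "mean_snr a \<theta> R = a \<theta> * R powi (- 4)"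

definition realized_snr ::
    "(real \<Rightarrow> real) \<Rightarrow> real \<Rightarrow> (nat \<Rightarrow> 'w \<Rightarrow> real) \<Rightarrow> real \<Rightarrow> nat \<Rightarrow> real \<Rightarrow> 'w \<Rightarrow> real" where
  "realized_snr a \<sigma>\<^sub>m \<sigma> \<theta> k R \<omega> = mean_snr a \<theta> R * \<sigma> k \<omega> / \<sigma>\<^sub>m"

definition integrated_snr ::
    "(real \<Rightarrow> real) \<Rightarrow> real \<Rightarrow> (nat \<Rightarrow> 'w \<Rightarrow> real) \<Rightarrow> real \<Rightarrow> nat \<Rightarrow> real \<Rightarrow> 'w \<Rightarrow> real" where
  "integrated_snr a \<sigma>\<^sub>m \<sigma> \<theta> K R \<omega> = (\<Sum>k = 1..K. realized_snr a \<sigma>\<^sub>m \<sigma> \<theta> k R \<omega>)"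

definition outage_prob ::
    "'w measure \<Rightarrow> (real \<Rightarrow> real) \<Rightarrow> real \<Rightarrow> (nat \<Rightarrow> 'w \<Rightarrow> real) \<Rightarrow> (nat \<Rightarrow> real) \<Rightarrow>
       (real \<Rightarrow> real) \<Rightarrow> real \<Rightarrow> nat \<Rightarrow> real" where
  "outage_prob P a \<sigma>\<^sub>m \<sigma> \<gamma>\<^sub>K R_target \<theta> K =
     measure P {\<omega> \<in> space P. integrated_snr a \<sigma>\<^sub>m \<sigma> \<theta> K (R_target \<theta>) \<omega> < \<gamma>\<^sub>K K}"

end

theory Submission
  imports Defs
begin

text \<open>
  A sum of \<open>K\<close> independent exponentials is Erlang, i.e. Gamma with integer shape \<open>K\<close>. Since the mean
  SNR scales as \<open>R\<^sup>-\<^sup>4\<close>, calibrating the threshold at the deterministic range turns the outage event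
  into the event that the normalised sum of the cross sections lies below
  \<open>K (R_target / R_det)\<^sup>4\<close>.
\<close>

text \<open>Rate \<open>l\<close> corresponds to scale \<open>1 / l\<close>, Gamma(n + 1) = n!, and
  \<open>powr\<close> with a natural exponent is an ordinary power. The origin is excluded because
  for \<open>n = 0\<close> the two densities disagree there: \<open>gamma_density\<close> is 0,
  \<open>erlang_density\<close> is \<open>l\<close>.\<close>

lemma gamma_density_Suc_eq_erlang_density:
  assumes "l > 0" and "x \<noteq> 0"
  shows "gamma_density (real (Suc n)) (1 / l) x = erlang_density n l x"
proof (cases "x < 0")
  case False
  then have x: "x > 0" using assms by simp
  have "Gamma (real (Suc n)) = fact n"
    using Gamma_fact[of n, where ?'a = real] by (simp add: add.commute)
  moreover have "x powr (real (Suc n) - 1) = x ^ n"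
    using x by (simp add: powr_realpow)
  moreover have "(1 / l) powr real (Suc n) = (1 / l) ^ Suc n"
    using assms by (intro powr_realpow) simp
  ultimately have "gamma_density (real (Suc n)) (1 / l) x
      = x ^ n * exp (- x / (1 / l)) / (fact n * (1 / l) ^ Suc n)"
    unfolding gamma_density_def using x by simp
  also have "\<dots> = erlang_density n l x"
    unfolding erlang_density_def using x assms(1)
    by (simp add: power_one_over field_simps)
  finally show ?thesis .
qed (simp add: gamma_density_def erlang_density_def)

text \<open>The densities can differ only at the origin, a Lebesgue null set, so they induce the
  same measure and hence the same CDF.\<close>

lemma gamma_cdf_Suc_eq_erlang_CDF:
  assumes "l > 0"
  shows "gamma_cdf (real (Suc n)) (1 / l) x = erlang_CDF n l x"
proof -
  have [measurable]: "gamma_density (real (Suc n)) (1 / l) \<in> borel_measurable borel"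
    unfolding gamma_density_def by measurable
  have "AE t in lborel. t \<noteq> (0 :: real)"
    by (rule AE_lborel_singleton)
  then have "AE t in lborel. ennreal (gamma_density (real (Suc n)) (1 / l) t)
      = ennreal (erlang_density n l t)"
    by eventually_elim (metis gamma_density_Suc_eq_erlang_density[OF assms])
  then have "density lborel (\<lambda>t. ennreal (gamma_density (real (Suc n)) (1 / l) t))
      = density lborel (\<lambda>t. ennreal (erlang_density n l t))"
    by (intro density_cong) measurable
  then show ?thesis
    using assms by (simp add: gamma_cdf_def cdf_def measure_def emeasure_erlang_density)
qed

text \<open>Outage is a strict inequality, whereas a CDF uses \<le>. As \<open>X\<close> has a
  density with respect to Lebesgue measure, it takes the value \<open>a\<close> with probability 0,
  so both events have the same probability.\<close>

lemma (in prob_space) erlang_distributed_less: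
  assumes D: "distributed M lborel X (erlang_density k l)" and "0 < l" "0 \<le> a"
  shows "\<P>(x in M. X x < a) = erlang_CDF k l a"
proof -
  have [measurable]: "X \<in> borel_measurable M"
    using distributed_measurable[OF D] by simp
  have "AE t in lborel. t \<noteq> a"
    by (rule AE_lborel_singleton)
  then have "AE x in M. X x \<noteq> a"
    by (subst distributed_AE2[OF D]) auto
  then have "\<P>(x in M. X x < a) = \<P>(x in M. X x \<le> a)"
    by (intro measure_eq_AE) auto
  also have "\<dots> = erlang_CDF k l a"
    using assms by (rule erlang_distributed_le)
  finally show ?thesis .
qed

text \<open>By the inverse fourth-power law, the mean SNR at \<open>D\<close> divided by that at
  \<open>R\<close> is \<open>(R / D) ^ 4\<close>; the positive factor \<open>a \<theta>\<close>
  cancels.\<close>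

lemma mean_snr_less_iff:
  assumes "a \<theta> > 0" and "R > 0" and "D > 0" and "\<sigma>\<^sub>m > 0"
  shows "mean_snr a \<theta> R * s / \<sigma>\<^sub>m < c * mean_snr a \<theta> D \<longleftrightarrow> s < \<sigma>\<^sub>m * (c * (R / D) ^ 4)"
  using assms by (simp add: mean_snr_def power_int_minus field_simps)

lemma det_range_pos:
  assumes "rcs > 0" and "K > 0"
    and "EIRP S > 0" and "rx_gain S > 0" and "wavelength S > 0"
    and "subcarriers S > 0" and "symbols_per_CPI S > 0"
    and "proc_efficiency S (rel_velocity S \<theta>) > 0"
    and "boltzmann_const S > 0" and "sys_temperature S > 0" and "bandwidth S > 0"
    and "snr_threshold S > 0"
  shows "det_range S rcs K \<theta> > 0"
  using assms by (simp add: det_range_def)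

theorem proposition5:
  fixes P :: "'w measure"
    and \<sigma> :: "nat \<Rightarrow> 'w \<Rightarrow> real"
    and \<sigma>\<^sub>m :: real
    and S :: radar_params
    and a R_target :: "real \<Rightarrow> real"
    and \<gamma>\<^sub>K :: "nat \<Rightarrow> real"
    and \<theta> :: real
    and K :: nat
  assumes "prob_space P"
    and "K \<ge> 1"
    and "\<sigma>\<^sub>m > 0"
    and "prob_space.indep_vars P (\<lambda>_. borel) \<sigma> {1..K}"
    and "\<And>k. k \<in> {1..K} \<Longrightarrow> distributed P lborel (\<sigma> k) (exponential_density (1 / \<sigma>\<^sub>m))"
    and "a \<theta> > 0"
    and "R_target \<theta> > 0"
    and "EIRP S > 0" and "rx_gain S > 0" and "wavelength S > 0"
    and "subcarriers S > 0" and "symbols_per_CPI S > 0"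
    and "proc_efficiency S (rel_velocity S \<theta>) > 0"
    and "boltzmann_const S > 0" and "sys_temperature S > 0" and "bandwidth S > 0"
    and "snr_threshold S > 0" and "integ_exponent S > 0"
    and "real K * mean_snr a \<theta> (det_range S \<sigma>\<^sub>m K \<theta>) = \<gamma>\<^sub>K K"
  shows "outage_prob P a \<sigma>\<^sub>m \<sigma> \<gamma>\<^sub>K R_target \<theta> K =
    gamma_cdf (real K) 1 (real K * (R_target \<theta> / det_range S \<sigma>\<^sub>m K \<theta>) ^ 4)"
proof -
  interpret prob_space P by fact
  let ?D = "det_range S \<sigma>\<^sub>m K \<theta>"
  let ?x = "real K * (R_target \<theta> / ?D) ^ 4"
  have D: "?D > 0"
    using assms by (intro det_range_pos) auto
  \<comment> \<open>The first argument of \<open>erlang_density\<close> is the shape minus one, so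
    \<open>K\<close> summands give index \<open>K - 1\<close>. The index set is nonempty because
    \<open>K \<ge> 1\<close>.\<close>
  have "distributed P lborel (\<lambda>\<omega>. \<Sum>k = 1..K. \<sigma> k \<omega>) (erlang_density (card {1..K} - 1) (1 / \<sigma>\<^sub>m))"
    using assms by (intro exponential_distributed_sum) auto
  then have sum_erlang: "distributed P lborel (\<lambda>\<omega>. \<Sum>k = 1..K. \<sigma> k \<omega>) (erlang_density (K - 1) (1 / \<sigma>\<^sub>m))"
    by simp
  have "integrated_snr a \<sigma>\<^sub>m \<sigma> \<theta> K (R_target \<theta>) \<omega> < \<gamma>\<^sub>K K \<longleftrightarrow> (\<Sum>k = 1..K. \<sigma> k \<omega>) < \<sigma>\<^sub>m * ?x" for \<omega>
  proof -
    have "integrated_snr a \<sigma>\<^sub>m \<sigma> \<theta> K (R_target \<theta>) \<omega>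
        = mean_snr a \<theta> (R_target \<theta>) * (\<Sum>k = 1..K. \<sigma> k \<omega>) / \<sigma>\<^sub>m"
      by (simp add: integrated_snr_def realized_snr_def sum_distrib_left sum_divide_distrib)
    \<comment> \<open>The calibration hypothesis rewrites the threshold
      \<open>\<gamma>\<^sub>K K\<close> as \<open>real K\<close> times the mean SNR at
      \<open>?D\<close>, so the SNR comparison applies with \<open>c = real K\<close>.\<close>
    then show ?thesis
      using mean_snr_less_iff[of a \<theta> "R_target \<theta>" ?D \<sigma>\<^sub>m] assms D by metis
  qed
  then have "outage_prob P a \<sigma>\<^sub>m \<sigma> \<gamma>\<^sub>K R_target \<theta> K
      = \<P>(\<omega> in P. (\<Sum>k = 1..K. \<sigma> k \<omega>) < \<sigma>\<^sub>m * ?x)"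
    by (simp add: outage_prob_def)
  also have "\<dots> = erlang_CDF (K - 1) (1 / \<sigma>\<^sub>m) (\<sigma>\<^sub>m * ?x)"
    using assms D by (intro erlang_distributed_less[OF sum_erlang]) auto
  \<comment> \<open>Rescaling to unit rate multiplies the argument by
    \<open>1 / \<sigma>\<^sub>m\<close>, which cancels the factor
    \<open>\<sigma>\<^sub>m\<close>.\<close>
  also have "\<dots> = erlang_CDF (K - 1) 1 ?x"
    using assms erlang_CDF_transform[of "1 / \<sigma>\<^sub>m"] by simp
  \<comment> \<open>Here \<open>K \<ge> 1\<close> ensures \<open>Suc (K - 1) = K\<close>, so index
    \<open>K - 1\<close> is shape \<open>K\<close>.\<close>
  also have "\<dots> = gamma_cdf (real K) 1 ?x"
    using gamma_cdf_Suc_eq_erlang_CDF[of 1 "K - 1" ?x] assms by simp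
  finally show ?thesis .
qed

end
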